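(* Let $n\ge 2$ and $m\ge n-1$ be integers. The weighted star $S^*=K_{1,n-1}\in\mathcal{T}(n,m)$ with edge weight sequence $(m-n+2,1,\dots,1)$ is the unique weighted star in $\mathcal{T}(n,m)$ having maximum energy among all weighted stars in $\mathcal{T}(n,m)$, and $\mathbb{E}(S^* )=2\sqrt{(m-n+2)^2+n-2}$.
   Context: $\mathcal{T}(n,m)$ denotes the set of trees on $n$ vertices in which every edge has a positive integer weight and the sum of all edge weights equals $m$. A weighted star is a tree in $\mathcal{T}(n,m)$ whose underlying tree is $K_{1,n-1}$ (one vertex adjacent to all others). The energy of a weighted graph $G$ is $\mathbb{E}(G)=\sum_i|\lambda_i|$, where $\lambda_i$ are the eigenvalues of the weighted adjacency matrix (the symmetric matrix whose $(i,j)$ entry is the weight of edge $ij$, or $0$ if there is no such edge). *)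

theory Defs
  imports Complex_Main "Jordan_Normal_Form.Spectral_Radius"
begin

text \<open>
  A weighted graph with \<open>num_verts G\<close> vertices has vertex set \<open>{..<num_verts G}\<close>; its edges are
  two-element sets of vertices. Values of \<open>weight\<close> outside the edge set carry no meaning and
  are never used below.
\<close>

record wgraph =
  num_verts :: nat
  edges :: "nat set set"
  weight :: "nat set \<Rightarrow> nat"

definition simple_graph :: "nat \<Rightarrow> nat set set \<Rightarrow> bool" where
  "simple_graph n E \<longleftrightarrow> (\<forall>e\<in>E. \<exists>u<n. \<exists>v<n. u \<noteq> v \<and> e = {u, v})"

definition connected_graph :: "nat \<Rightarrow> nat set set \<Rightarrow> bool" where
  "connected_graph n E \<longleftrightarrow> (\<forall>u<n. \<forall>v<n. (u, v) \<in> {(x, y). {x, y} \<in> E}\<^sup>*)"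

text \<open>A cycle is listed by its vertices, each once, and closes up from the last to the first.\<close>

definition is_cycle :: "nat set set \<Rightarrow> nat list \<Rightarrow> bool" where
  "is_cycle E vs \<longleftrightarrow> 3 \<le> length vs \<and> distinct vs \<and>
     (\<forall>i<length vs. {vs ! i, vs ! (Suc i mod length vs)} \<in> E)"

definition is_tree :: "nat \<Rightarrow> nat set set \<Rightarrow> bool" where
  "is_tree n E \<longleftrightarrow> simple_graph n E \<and> connected_graph n E \<and> (\<nexists>vs. is_cycle E vs)"

definition weighted_trees :: "nat \<Rightarrow> nat \<Rightarrow> wgraph set" where
  "weighted_trees n m = {G. num_verts G = n \<and> is_tree n (edges G) \<and>
     (\<forall>e\<in>edges G. 0 < weight G e) \<and> (\<Sum>e\<in>edges G. weight G e) = m}"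

text \<open>The centre of a star may be any of the labelled vertices.\<close>

definition is_star :: "nat \<Rightarrow> nat set set \<Rightarrow> bool" where
  "is_star n E \<longleftrightarrow> (\<exists>c<n. E = {{c, v} | v. v < n \<and> v \<noteq> c})"

definition weighted_stars :: "nat \<Rightarrow> nat \<Rightarrow> wgraph set" where
  "weighted_stars n m = {G \<in> weighted_trees n m. is_star n (edges G)}"

definition wgraph_iso :: "wgraph \<Rightarrow> wgraph \<Rightarrow> bool" where
  "wgraph_iso G H \<longleftrightarrow> (\<exists>f. bij_betw f {..<num_verts G} {..<num_verts H} \<and>
     (\<forall>u<num_verts G. \<forall>v<num_verts G.
        ({u, v} \<in> edges G \<longleftrightarrow> {f u, f v} \<in> edges H) \<and>
        ({u, v} \<in> edges G \<longrightarrow> weight G {u, v} = weight H {f u, f v})))"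

definition adj_matrix :: "wgraph \<Rightarrow> real mat" where
  "adj_matrix G = mat (num_verts G) (num_verts G)
     (\<lambda>(i, j). if {i, j} \<in> edges G then real (weight G {i, j}) else 0)"

text \<open>
  Eigenvalues are counted with algebraic multiplicity. The adjacency matrix is real symmetric, so
  its real spectrum comprises all of its eigenvalues.
\<close>

definition energy :: "wgraph \<Rightarrow> real" where
  "energy G = (\<Sum>k\<in>spectrum (adj_matrix G).
     real (Polynomial.order k (char_poly (adj_matrix G))) * \<bar>k\<bar>)"

text \<open>
  The star with centre 0 and leaves 1, ..., \<open>length ws\<close>; the leaf \<open>i\<close> is the maximum of the
  edge \<open>{0, i}\<close>, which gets weight \<open>ws ! (i - 1)\<close>.
\<close>

definition star_of_weights :: "nat list \<Rightarrow> wgraph" where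
  "star_of_weights ws = \<lparr>num_verts = Suc (length ws),
     edges = {{0, i} | i. 1 \<le> i \<and> i \<le> length ws},
     weight = (\<lambda>e. ws ! (Max e - 1))\<rparr>"

text \<open>
  The weight m - n + 2 is written m + 2 - n, which for \<open>n - 1 \<le> m\<close> is not truncated.
\<close>

definition max_star :: "nat \<Rightarrow> nat \<Rightarrow> wgraph" where
  "max_star n m = star_of_weights ((m + 2 - n) # replicate (n - 2) 1)"

end

theory Submission
  imports Defs "HOL-Combinatorics.Transposition"
begin

text \<open>
  A weighted star with leaf weights \<open>w\<close> has characteristic polynomial
  \<open>X^(n - 2) (X\<^sup>2 - S)\<close> where \<open>S\<close> is the sum of the squares of the \<open>w v\<close>, hence energy
  \<open>2 sqrt S\<close>. Writing \<open>w v = u v + 1\<close> with \<open>u v \<ge> 0\<close>, the sum of the \<open>u v\<close> is fixed, and so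
  the sum of the \<open>(u v)\<^sup>2\<close> is largest exactly when at most one \<open>u v\<close> is nonzero.
\<close>

section \<open>The characteristic polynomial of a weighted star\<close>

text \<open>Laplace expansion along column \<open>c\<close> leaves only the diagonal term, and its
  sign \<open>(-1) ^ (c + c)\<close> is 1.\<close>

lemma det_single_nonzero_in_col:
  fixes A :: "'a :: comm_ring_1 mat"
  assumes A: "A \<in> carrier_mat n n" and c: "c < n"
    and zero: "\<And>i. i < n \<Longrightarrow> i \<noteq> c \<Longrightarrow> A $$ (i, c) = 0"
  shows "det A = A $$ (c, c) * det (mat_delete A c c)"
proof -
  have "det A = (\<Sum>i<n. A $$ (i, c) * cofactor A i c)"
    by (rule laplace_expansion_column[OF A c])
  also have "\<dots> = (\<Sum>i\<in>{c}. A $$ (i, c) * cofactor A i c)"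
    using c zero by (intro sum.mono_neutral_right) auto
  finally show ?thesis by (simp add: cofactor_def)
qed

lemma det_single_nonzero_in_row:
  fixes A :: "'a :: comm_ring_1 mat"
  assumes A: "A \<in> carrier_mat n n" and c: "c < n"
    and zero: "\<And>j. j < n \<Longrightarrow> j \<noteq> c \<Longrightarrow> A $$ (c, j) = 0"
  shows "det A = A $$ (c, c) * det (mat_delete A c c)"
proof -
  have "det A = (\<Sum>j<n. A $$ (c, j) * cofactor A c j)"
    by (rule laplace_expansion_row[OF A c])
  also have "\<dots> = (\<Sum>j\<in>{c}. A $$ (c, j) * cofactor A c j)"
    using c zero by (intro sum.mono_neutral_right) auto
  finally show ?thesis by (simp add: cofactor_def)
qed

definition star_matrix :: "nat \<Rightarrow> nat \<Rightarrow> (nat \<Rightarrow> 'a) \<Rightarrow> 'a :: zero mat" where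
  "star_matrix n c w = mat n n
     (\<lambda>(i, j). if i = c \<and> j \<noteq> c then w j else if j = c \<and> i \<noteq> c then w i else 0)"

text \<open>For \<open>M = X I - A\<close> a matrix \<open>B\<close> with \<open>det B = X\<close>
  is chosen so that column \<open>c\<close> of \<open>M * B\<close> is \<open>X^2 - S\<close> on the
  diagonal and 0 elsewhere. Expanding along it gives
  \<open>det M * X = (X^2 - S) * X^(n - 1)\<close>, and one \<open>X\<close> cancels.\<close>

lemma char_poly_star_matrix:
  fixes w :: "nat \<Rightarrow> 'a :: idom"
  assumes n: "2 \<le> n" and c: "c < n"
  shows "char_poly (star_matrix n c w) =
    monom 1 (n - 2) * [:- (\<Sum>v\<in>{..<n} - {c}. (w v)\<^sup>2), 0, 1:]"
proof -
  define S where "S = (\<Sum>v\<in>{..<n} - {c}. (w v)\<^sup>2)"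
  define X :: "'a poly" where "X = [:0, 1:]"
  define M where "M = char_poly_matrix (star_matrix n c w)"
  \<comment> \<open>Multiplying by \<open>B\<close> clears the off-diagonal entries of column \<open>c\<close> of \<open>M\<close>.\<close>
  define B where "B = mat n n
    (\<lambda>(i, j). if j = c then (if i = c then X else [:w i:]) else if i = j then 1 else 0)"
  have M: "M \<in> carrier_mat n n" and B: "B \<in> carrier_mat n n"
    unfolding M_def B_def char_poly_matrix_def star_matrix_def by auto
  have M_entry: "M $$ (i, j) = (if i = j then X
      else if i = c then [:- w j:] else if j = c then [:- w i:] else 0)"
    if "i < n" "j < n" for i j
    using that by (auto simp: M_def char_poly_matrix_def star_matrix_def X_def)
  have B_entry: "B $$ (i, j) =
      (if j = c then (if i = c then X else [:w i:]) else if i = j then 1 else 0)"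
    if "i < n" "j < n" for i j
    using that by (simp add: B_def)
  have MB_sum: "(M * B) $$ (i, j) = (\<Sum>k<n. M $$ (i, k) * B $$ (k, j))"
    if "i < n" "j < n" for i j
    using that M B by (simp add: scalar_prod_def atLeast0LessThan)
  have other_col: "(M * B) $$ (i, j) = M $$ (i, j)" if "i < n" "j < n" "j \<noteq> c" for i j
  proof -
    have "(M * B) $$ (i, j) = (\<Sum>k<n. if k = j then M $$ (i, k) else 0)"
      unfolding MB_sum[OF that(1,2)] using that by (intro sum.cong) (auto simp: B_entry)
    thus ?thesis using that by simp
  qed
  have split_c: "{..<n} = insert c ({..<n} - {c})" using c by auto
  have col_c: "(M * B) $$ (i, c) = (if i = c then [:- S, 0, 1:] else 0)" if i: "i < n" for i
  proof -
    have "(M * B) $$ (i, c) = M $$ (i, c) * B $$ (c, c) +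
        (\<Sum>k\<in>{..<n} - {c}. M $$ (i, k) * B $$ (k, c))"
      unfolding MB_sum[OF i c] using c by (simp add: sum.remove)
    \<comment> \<open>Row \<open>c\<close> yields \<open>X * X\<close> minus the sum of the squares;
      in any other row \<open>- w i * X\<close> cancels against the diagonal term
      \<open>X * w i\<close>.\<close>
    also have "\<dots> = (if i = c then [:- S, 0, 1:] else 0)"
    proof (cases "i = c")
      case True
      have "(\<Sum>k\<in>{..<n} - {c}. M $$ (i, k) * B $$ (k, c)) =
          (\<Sum>k\<in>{..<n} - {c}. [:- ((w k)\<^sup>2):])"
        using True c by (intro sum.cong) (auto simp: M_entry B_entry power2_eq_square)
      also have "\<dots> = [:- S:]"
        unfolding S_def sum_negf[symmetric] by (simp only: sum_to_poly)
      finally show ?thesis using True c by (simp add: M_entry B_entry X_def)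
    next
      case False
      have "(\<Sum>k\<in>{..<n} - {c}. M $$ (i, k) * B $$ (k, c)) =
          (\<Sum>k\<in>{..<n} - {c}. if k = i then X * [:w i:] else 0)"
        using False c i by (intro sum.cong) (auto simp: M_entry B_entry)
      also have "\<dots> = X * [:w i:]" using False i by simp
      finally show ?thesis using False c i by (simp add: M_entry B_entry X_def)
    qed
    finally show ?thesis .
  qed
  have "det B = X * det (mat_delete B c c)"
    using det_single_nonzero_in_row[OF B c] c by (simp add: B_entry)
  also have "mat_delete B c c = 1\<^sub>m (n - 1)"
    using B c by (intro eq_matI) (auto simp: mat_delete_def B_entry)
  finally have det_B: "det B = X" by simp
  \<comment> \<open>All nonzero off-diagonal entries of \<open>M\<close> lie in row or column
    \<open>c\<close>, so only the diagonal survives the deletion.\<close>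
  have "mat_delete (M * B) c c = X \<cdot>\<^sub>m 1\<^sub>m (n - 1)"
    using M B c
    by (intro eq_matI)
      (auto simp: mat_delete_def other_col M_entry simp del: index_mult_mat(1))
  hence "det (M * B) = [:- S, 0, 1:] * X ^ (n - 1)"
    using det_single_nonzero_in_col[of "M * B" n c] M B c
    by (simp add: col_c det_smult del: index_mult_mat(1))
  hence "det M * X = [:- S, 0, 1:] * X ^ (n - 1)"
    by (simp add: det_mult[OF M B] det_B)
  \<comment> \<open>Splits off one factor \<open>X\<close> on the right, to be cancelled in the
    integral domain of polynomials.\<close>
  also have "n - 1 = Suc (n - 2)" using n by simp
  finally have "X * det M = X * (X ^ (n - 2) * [:- S, 0, 1:])"
    by (simp add: mult_ac)
  hence "det M = X ^ (n - 2) * [:- S, 0, 1:]" by (simp add: X_def)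
  thus ?thesis
    by (simp add: char_poly_def M_def S_def X_def x_as_monom monom_power)
qed

lemma order_linear_root: "Polynomial.order a [:- a, 1 :: 'a :: idom:] = 1"
  using order_power_n_n[of a 1] by simp

text \<open>The cofactor \<open>X^k (X + r)\<close> of \<open>X - r\<close> does not vanish at
  \<open>r\<close>, so the root is simple. Since \<open>r\<close> may be negative, this covers both
  square roots of \<open>r\<^sup>2\<close>.\<close>

lemma order_real_square_minus:
  fixes r :: real
  assumes "r \<noteq> 0"
  shows "Polynomial.order r (monom 1 k * [:- (r\<^sup>2), 0, 1:]) = 1"
proof -
  define q where "q = monom 1 k * [:r, 1:]"
  have "[:- (r\<^sup>2), 0, 1:] = [:r, 1:] * [:- r, 1:]"
    by (simp add: power2_eq_square)
  hence eq: "monom 1 k * [:- (r\<^sup>2), 0, 1:] = q * [:- r, 1:]"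
    by (simp only: q_def mult.assoc)
  have nz: "poly q r \<noteq> 0"
    using assms by (simp add: q_def poly_monom)
  hence prod_nz: "q * [:- r, 1:] \<noteq> 0"
    by (metis mult_eq_0_iff one_pCons pCons_eq_0_iff poly_0 zero_neq_one)
  show ?thesis
    unfolding eq order_mult[OF prod_nz] order_linear_root order_0I[OF nz] by simp
qed

section \<open>The energy of a weighted star\<close>

lemma adj_matrix_star:
  assumes "num_verts G = n" "edges G = {{c, v} | v. v < n \<and> v \<noteq> c}"
  shows "adj_matrix G = star_matrix n c (\<lambda>v. real (weight G {c, v}))"
proof -
  have "{i, j} \<in> edges G \<longleftrightarrow> (i = c \<and> j \<noteq> c) \<or> (j = c \<and> i \<noteq> c)" if "i < n" "j < n" for i j
    using that assms(2) by (auto simp: doubleton_eq_iff)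
  thus ?thesis
    unfolding adj_matrix_def star_matrix_def
    by (intro eq_matI) (auto simp: assms(1) insert_commute)
qed

text \<open>The nonzero eigenvalues are \<open>r\<close> and \<open>- r\<close>, both simple, where
  \<open>r\<close> is the square root on the right-hand side.\<close>

lemma energy_star:
  assumes n: "2 \<le> n" and c: "c < n"
    and G: "num_verts G = n" "edges G = {{c, v} | v. v < n \<and> v \<noteq> c}"
    and pos: "\<forall>e\<in>edges G. 0 < weight G e"
  shows "energy G = 2 * sqrt (real (\<Sum>v\<in>{..<n} - {c}. (weight G {c, v})\<^sup>2))"
proof -
  define r where "r = sqrt (real (\<Sum>v\<in>{..<n} - {c}. (weight G {c, v})\<^sup>2))"
  \<comment> \<open>A leaf exists because \<open>2 \<le> n\<close>; its positive weight makes
    \<open>r > 0\<close>, so \<open>r\<close> and \<open>- r\<close> are distinct.\<close>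
  obtain v where v: "v < n" "v \<noteq> c"
    using n by (cases "c = 0") (auto intro: that[of 1] that[of 0])
  have "0 < weight G {c, v}" using pos G v by auto
  hence "0 < (\<Sum>v\<in>{..<n} - {c}. (weight G {c, v})\<^sup>2)"
    using v by (intro sum_pos2[of _ v]) auto
  hence r: "r > 0" by (simp add: r_def del: of_nat_sum)
  have r_sq: "r\<^sup>2 = (\<Sum>v\<in>{..<n} - {c}. (real (weight G {c, v}))\<^sup>2)"
    by (simp add: r_def sum_nonneg)
  define p where "p = char_poly (adj_matrix G)"
  have p: "p = monom 1 (n - 2) * [:- (r\<^sup>2), 0, 1:]"
    unfolding p_def adj_matrix_star[OF G] char_poly_star_matrix[OF n c] r_sq ..
  have A: "adj_matrix G \<in> carrier_mat n n" by (simp add: adj_matrix_def G(1))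
  have spec: "k \<in> spectrum (adj_matrix G) \<longleftrightarrow> poly p k = 0" for k
    by (simp add: spectrum_def eigenvalue_root_char_poly[OF A] p_def)
  have root: "poly p k = 0 \<longleftrightarrow> (k = 0 \<and> n \<noteq> 2) \<or> k = r \<or> k = - r" for k
  proof -
    have "poly p k = k ^ (n - 2) * (k\<^sup>2 - r\<^sup>2)"
      by (simp add: p poly_monom power2_eq_square algebra_simps)
    thus ?thesis using n by (auto simp: power2_eq_iff)
  qed
  have "finite (spectrum (adj_matrix G))" by (rule card_finite_spectrum[OF A])
  \<comment> \<open>The eigenvalue 0, present when \<open>n \<noteq> 2\<close>, contributes 0
    whatever its multiplicity.\<close>
  hence "energy G = (\<Sum>k\<in>{r, - r}. real (Polynomial.order k p) * \<bar>k\<bar>)"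
    unfolding energy_def p_def[symmetric]
    by (intro sum.mono_neutral_right) (auto simp: spec root)
  also have "\<dots> = 2 * r"
    using r order_real_square_minus[of r "n - 2"] order_real_square_minus[of "- r" "n - 2"]
    by (simp add: p)
  finally show ?thesis by (simp only: r_def)
qed

section \<open>Sums of squares with prescribed sum\<close>

text \<open>Positivity makes the natural subtraction exact, so this is
  \<open>(u + 1)^2 = u^2 + 2 u + 1\<close> summed over \<open>I\<close>, with
  \<open>u = w i - 1\<close>.\<close>

lemma sum_squares_eq_sum_excess:
  fixes w :: "'a \<Rightarrow> nat"
  assumes "finite I" and pos: "\<forall>i\<in>I. 0 < w i"
  shows "(\<Sum>i\<in>I. (w i)\<^sup>2) = (\<Sum>i\<in>I. (w i - 1)\<^sup>2) + 2 * (\<Sum>i\<in>I. w i - 1) + card I"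
    and "(\<Sum>i\<in>I. w i) = (\<Sum>i\<in>I. w i - 1) + card I"
proof -
  have "(w i)\<^sup>2 = (w i - 1)\<^sup>2 + 2 * (w i - 1) + 1" "w i = (w i - 1) + 1" if "i \<in> I" for i
    using bspec[OF pos that] by (cases "w i"; simp add: power2_eq_square)+
  hence "(\<Sum>i\<in>I. (w i)\<^sup>2) = (\<Sum>i\<in>I. (w i - 1)\<^sup>2 + 2 * (w i - 1) + 1)"
    and "(\<Sum>i\<in>I. w i) = (\<Sum>i\<in>I. (w i - 1) + 1)"
    by (auto intro!: sum.cong)
  thus "(\<Sum>i\<in>I. (w i)\<^sup>2) = (\<Sum>i\<in>I. (w i - 1)\<^sup>2) + 2 * (\<Sum>i\<in>I. w i - 1) + card I"
    and "(\<Sum>i\<in>I. w i) = (\<Sum>i\<in>I. w i - 1) + card I"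
    unfolding sum.distrib sum_distrib_left[symmetric] by simp_all
qed

text \<open>With \<open>M\<close> the total, \<open>(u i)\<^sup>2 \<le> u i * M\<close>, and the
  right-hand sides add up to \<open>M\<^sup>2\<close>. Equality forces every \<open>u i\<close> to
  be 0 or \<open>M\<close>.\<close>

lemma sum_squares_le_square_sum:
  fixes u :: "'a \<Rightarrow> nat"
  assumes "finite I"
  shows "(\<Sum>i\<in>I. (u i)\<^sup>2) \<le> (\<Sum>i\<in>I. u i)\<^sup>2"
    and "(\<Sum>i\<in>I. (u i)\<^sup>2) = (\<Sum>i\<in>I. u i)\<^sup>2 \<Longrightarrow> I \<noteq> {} \<Longrightarrow>
      \<exists>i\<in>I. u i = (\<Sum>i\<in>I. u i) \<and> (\<forall>j\<in>I. j \<noteq> i \<longrightarrow> u j = 0)"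
proof -
  define M where "M = (\<Sum>i\<in>I. u i)"
  have le: "u i \<le> M" if "i \<in> I" for i
    unfolding M_def by (rule member_le_sum) (use assms that in auto)
  have sq_le: "(u i)\<^sup>2 \<le> u i * M" if "i \<in> I" for i
    using le[OF that] by (simp add: power2_eq_square)
  have M2: "(\<Sum>i\<in>I. u i * M) = M\<^sup>2"
    by (simp add: M_def power2_eq_square sum_distrib_right)
  show "(\<Sum>i\<in>I. (u i)\<^sup>2) \<le> (\<Sum>i\<in>I. u i)\<^sup>2"
    using sum_mono[of I "\<lambda>i. (u i)\<^sup>2" "\<lambda>i. u i * M"] sq_le M2 by (simp add: M_def)
  assume eq: "(\<Sum>i\<in>I. (u i)\<^sup>2) = (\<Sum>i\<in>I. u i)\<^sup>2" and ne: "I \<noteq> {}"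
  have "(\<Sum>i\<in>I. (u i)\<^sup>2) = (\<Sum>i\<in>I. u i * M)" using eq M2 by (simp add: M_def)
  \<comment> \<open>Equal sums of termwise ordered summands agree term by term.\<close>
  hence "(u i)\<^sup>2 = u i * M" if "i \<in> I" for i
    using sum_mono_inv[of "\<lambda>i. (u i)\<^sup>2" I "\<lambda>i. u i * M" i] sq_le assms that by simp
  hence zero_or_M: "u i = 0 \<or> u i = M" if "i \<in> I" for i
    using that by (auto simp: power2_eq_square)
  \<comment> \<open>Otherwise all \<open>u i\<close> vanish, hence \<open>M = 0\<close>, and any
    element of the nonempty \<open>I\<close> attains \<open>M\<close> after all.\<close>
  have "\<exists>i\<in>I. u i = M"
  proof (rule ccontr)
    assume none: "\<not> (\<exists>i\<in>I. u i = M)"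
    hence "\<forall>i\<in>I. u i = 0" using zero_or_M by blast
    hence "M = 0" by (simp add: M_def)
    thus False using none ne \<open>\<forall>i\<in>I. u i = 0\<close> by auto
  qed
  then obtain i where i: "i \<in> I" "u i = M" by blast
  have "(\<Sum>j\<in>I - {i}. u j) = 0"
    using sum.remove[OF assms i(1), of u] i(2) by (simp add: M_def)
  hence "\<forall>j\<in>I. j \<noteq> i \<longrightarrow> u j = 0" using assms by auto
  thus "\<exists>i\<in>I. u i = (\<Sum>i\<in>I. u i) \<and> (\<forall>j\<in>I. j \<noteq> i \<longrightarrow> u j = 0)"
    using i M_def by auto
qed

text \<open>The number \<open>a\<close> is what one entry must be when all others are 1. In terms of
  the excesses \<open>w i - 1\<close> with total \<open>M\<close>, \<open>a = M + 1\<close> and both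
  sides contain \<open>2 * M + card I\<close>, so only the sum of squared excesses is compared with
  \<open>M\<^sup>2\<close>.\<close>

lemma sum_squares_positive_bound:
  fixes w :: "'a \<Rightarrow> nat"
  assumes "finite I" and pos: "\<forall>i\<in>I. 0 < w i" and ne: "I \<noteq> {}"
  defines "a \<equiv> (\<Sum>i\<in>I. w i) + 1 - card I"
  shows "(\<Sum>i\<in>I. (w i)\<^sup>2) \<le> a\<^sup>2 + (card I - 1)"
    and "(\<Sum>i\<in>I. (w i)\<^sup>2) = a\<^sup>2 + (card I - 1) \<Longrightarrow>
      \<exists>i\<in>I. w i = a \<and> (\<forall>j\<in>I. j \<noteq> i \<longrightarrow> w j = 1)"
proof -
  define M where "M = (\<Sum>i\<in>I. w i - 1)"
  note excess = sum_squares_eq_sum_excess[OF assms(1) pos, folded M_def]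
  have a: "a = M + 1" using excess(2) by (simp add: a_def)
  have "0 < card I" using assms(1) ne by (simp add: card_gt_0_iff)
  hence bound: "a\<^sup>2 + (card I - 1) = M\<^sup>2 + 2 * M + card I"
    by (simp add: a power2_eq_square)
  show "(\<Sum>i\<in>I. (w i)\<^sup>2) \<le> a\<^sup>2 + (card I - 1)"
    using sum_squares_le_square_sum(1)[OF assms(1), of "\<lambda>i. w i - 1"]
    unfolding bound excess(1) by (simp add: M_def)
  assume "(\<Sum>i\<in>I. (w i)\<^sup>2) = a\<^sup>2 + (card I - 1)"
  hence "(\<Sum>i\<in>I. (w i - 1)\<^sup>2) = (\<Sum>i\<in>I. w i - 1)\<^sup>2"
    unfolding bound excess(1) by (simp add: M_def)
  from sum_squares_le_square_sum(2)[OF assms(1) this ne]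
  obtain i where i: "i \<in> I" "w i - 1 = M" "\<forall>j\<in>I. j \<noteq> i \<longrightarrow> w j - 1 = 0"
    by (auto simp: M_def)
  have "w i = a" using i(1,2) pos by (metis Suc_eq_plus1 Suc_pred' a)
  moreover have "w j = 1" if "j \<in> I" "j \<noteq> i" for j
    using i(3) pos that by (metis One_nat_def Suc_pred)
  ultimately show "\<exists>i\<in>I. w i = a \<and> (\<forall>j\<in>I. j \<noteq> i \<longrightarrow> w j = 1)" using i(1) by blast
qed

section \<open>Weighted stars\<close>

lemma sum_star_edges:
  "(\<Sum>e\<in>{{c, v} | v. v < n \<and> v \<noteq> c}. f e) = (\<Sum>v\<in>{..<n} - {c}. f {c, v})"
proof -
  have "{{c, v} | v. v < n \<and> v \<noteq> c} = (\<lambda>v. {c, v}) ` ({..<n} - {c})" by auto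
  moreover have "inj_on (\<lambda>v. {c, v}) ({..<n} - {c})"
    by (auto simp: inj_on_def doubleton_eq_iff)
  ultimately show ?thesis by (simp add: sum.reindex)
qed

text \<open>Any two vertices are joined through \<open>c\<close>. Every edge of a cycle would
  contain \<open>c\<close>, but \<open>c\<close> occurs only once in it and cannot meet three
  consecutive edges.\<close>

lemma is_tree_star:
  assumes c: "c < n"
  shows "is_tree n {{c, v} | v. v < n \<and> v \<noteq> c}" (is "is_tree n ?E")
  unfolding is_tree_def
proof (intro conjI)
  show "simple_graph n ?E"
    unfolding simple_graph_def using c by fastforce
  let ?R = "{(x, y). {x, y} \<in> ?E}"
  have to_c: "(u, c) \<in> ?R\<^sup>*" and from_c: "(c, u) \<in> ?R\<^sup>*" if "u < n" for u
  proof -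
    have "(u, c) \<in> ?R" "(c, u) \<in> ?R" if "u \<noteq> c"
      using that \<open>u < n\<close> by (auto simp: doubleton_eq_iff)
    thus "(u, c) \<in> ?R\<^sup>*" "(c, u) \<in> ?R\<^sup>*"
      by (cases "u = c"; simp add: r_into_rtrancl)+
  qed
  show "connected_graph n ?E"
    unfolding connected_graph_def using to_c from_c by (blast intro: rtrancl_trans)
  show "\<nexists>vs. is_cycle ?E vs"
  proof
    assume "\<exists>vs. is_cycle ?E vs"
    then obtain vs where len: "3 \<le> length vs" and dist: "distinct vs"
      and edge: "\<And>i. i < length vs \<Longrightarrow> {vs ! i, vs ! (Suc i mod length vs)} \<in> ?E"
      by (auto simp: is_cycle_def)
    have has_c: "vs ! i = c \<or> vs ! (Suc i mod length vs) = c" if "i < length vs" for i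
      using edge[OF that] by (auto simp: doubleton_eq_iff)
    have inj: "i = j" if "vs ! i = c" "vs ! j = c" "i < length vs" "j < length vs" for i j
      using dist that nth_eq_iff_index_eq by metis
    have 0: "vs ! 0 = c \<or> vs ! 1 = c" using has_c[of 0] len by (cases vs) auto
    have 1: "vs ! 1 = c \<or> vs ! 2 = c" using has_c[of 1] len by (simp add: numeral_2_eq_2)
    have 2: "vs ! 2 = c \<or> vs ! (3 mod length vs) = c"
      using has_c[of 2] len by (simp add: numeral_3_eq_3 numeral_2_eq_2)
    \<comment> \<open>Otherwise \<open>c\<close> would stand at both positions 0 and 2.\<close>
    have "vs ! 1 = c" using 0 1 inj[of 0 2] len by fastforce
    \<comment> \<open>The successor of position 2 is 0 in a triangle and 3 in a longer cycle, so the
      edge leaving position 2 misses \<open>c\<close>.\<close>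
    moreover have "3 mod length vs \<noteq> 1" "3 mod length vs < length vs"
      using len by (cases "length vs = 3"; simp)+
    ultimately show False using 2 inj[of 1 2] inj[of 1 "3 mod length vs"] len by fastforce
  qed
qed

lemma weighted_starsE:
  assumes "G \<in> weighted_stars n m"
  obtains c where "c < n" "num_verts G = n" "edges G = {{c, v} | v. v < n \<and> v \<noteq> c}"
    "\<forall>e\<in>edges G. 0 < weight G e" "(\<Sum>v\<in>{..<n} - {c}. weight G {c, v}) = m"
  using assms unfolding weighted_stars_def weighted_trees_def is_star_def
  by (auto simp: sum_star_edges)

lemma num_verts_max_star: "2 \<le> n \<Longrightarrow> num_verts (max_star n m) = n"
  by (simp add: max_star_def star_of_weights_def)

lemma edges_max_star:
  "2 \<le> n \<Longrightarrow> edges (max_star n m) = {{0, v} | v. v < n \<and> v \<noteq> 0}"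
  by (force simp: max_star_def star_of_weights_def)

text \<open>Since \<open>Max {0, v} = v\<close>, leaf \<open>v\<close> reads list entry
  \<open>v - 1\<close>; the head of the list belongs to leaf 1.\<close>

lemma weight_max_star:
  "v < n \<Longrightarrow> v \<noteq> 0 \<Longrightarrow> weight (max_star n m) {0, v} = (if v = 1 then m + 2 - n else 1)"
  by (auto simp: max_star_def star_of_weights_def nth_Cons')

text \<open>A general \<open>f\<close> serves both the total weight (identity) and the energy
  (squaring).\<close>

lemma sum_max_star:
  fixes f :: "nat \<Rightarrow> nat"
  assumes "2 \<le> n"
  shows "(\<Sum>v\<in>{..<n} - {0}. f (weight (max_star n m) {0, v})) = f (m + 2 - n) + (n - 2) * f 1"
proof -
  have "{..<n} - {0} = insert 1 {2..<n}" using assms by auto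
  thus ?thesis using assms by (simp add: weight_max_star)
qed

lemma max_star_in_weighted_stars:
  assumes "2 \<le> n" and "n - 1 \<le> m"
  shows "max_star n m \<in> weighted_stars n m"
proof -
  \<comment> \<open>The hypothesis \<open>n - 1 \<le> m\<close> gives
    \<open>m + 2 - n \<ge> 1\<close>.\<close>
  have "0 < weight (max_star n m) e" if "e \<in> edges (max_star n m)" for e
    using that assms by (auto simp: edges_max_star weight_max_star)
  moreover have "(\<Sum>e\<in>edges (max_star n m). weight (max_star n m) e) = m"
    unfolding edges_max_star[OF assms(1)] sum_star_edges
      sum_max_star[OF assms(1), of "\<lambda>x. x"] using assms by simp
  ultimately show ?thesis
    using assms is_tree_star[of 0 n]
    unfolding weighted_stars_def weighted_trees_def is_star_def
    by (simp add: num_verts_max_star edges_max_star exI[of _ 0])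
qed

text \<open>A permutation taking \<open>c\<close> to 0 and \<open>i\<close> to 1 suffices: the
  remaining leaves all carry weight 1, so their order is immaterial.\<close>

lemma star_iso_max_star:
  assumes n: "2 \<le> n" and c: "c < n"
    and G: "num_verts G = n" "edges G = {{c, v} | v. v < n \<and> v \<noteq> c}"
    and i: "i < n" "i \<noteq> c" "weight G {c, i} = m + 2 - n"
    and others: "\<And>v. v < n \<Longrightarrow> v \<noteq> c \<Longrightarrow> v \<noteq> i \<Longrightarrow> weight G {c, v} = 1"
  shows "wgraph_iso G (max_star n m)"
proof -
  \<comment> \<open>\<open>j\<close> is the place of \<open>i\<close> once \<open>c\<close> has been
    swapped to 0. It is nonzero because \<open>i \<noteq> c\<close>, so the second swap leaves 0
    fixed.\<close>
  define j where "j = transpose 0 c i"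
  define f where "f = transpose 1 j \<circ> transpose 0 c"
  have j: "j \<noteq> 0" "j < n" using i c n by (auto simp: j_def transpose_def)
  have "f ` {..<n} \<subseteq> {..<n}" using n c j by (auto simp: f_def transpose_def)
  moreover have inj: "inj f" by (simp add: f_def inj_compose)
  ultimately have bij: "bij_betw f {..<n} {..<n}"
    by (metis bij_betw_def endo_inj_surj finite_lessThan inj_on_subset subset_UNIV)
  have fc: "f c = 0" using j by (simp add: f_def transpose_def)
  have fi: "f i = 1" by (simp add: f_def j_def[symmetric])
  have f_eq: "f v = 0 \<longleftrightarrow> v = c" "f v = 1 \<longleftrightarrow> v = i" for v
    using inj fc fi by (metis injD)+
  have f_less: "f v < n" if "v < n" for v using bij that by (auto simp: bij_betw_def)
  have edge_G: "{u, v} \<in> edges G \<longleftrightarrow> (u = c \<and> v \<noteq> c) \<or> (v = c \<and> u \<noteq> c)"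
    if "u < n" "v < n" for u v
    using that by (auto simp: G doubleton_eq_iff)
  have edge_S: "{u, v} \<in> edges (max_star n m) \<longleftrightarrow> (u = 0 \<and> v \<noteq> 0) \<or> (v = 0 \<and> u \<noteq> 0)"
    if "u < n" "v < n" for u v
    using that by (auto simp: edges_max_star[OF n] doubleton_eq_iff)
  have weight_eq: "weight G {c, v} = weight (max_star n m) {0, f v}" if "v < n" "v \<noteq> c" for v
    using that i others weight_max_star[of "f v" n m] f_less f_eq by auto
  have "weight G {u, v} = weight (max_star n m) {f u, f v}"
    if "u < n" "v < n" "{u, v} \<in> edges G" for u v
    using that(3) weight_eq[of u] weight_eq[of v] that(1,2) fc
    by (auto simp: edge_G insert_commute)
  moreover have "{u, v} \<in> edges G \<longleftrightarrow> {f u, f v} \<in> edges (max_star n m)"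
    if "u < n" "v < n" for u v
    using that f_less by (simp add: edge_G edge_S f_eq)
  ultimately show ?thesis
    unfolding wgraph_iso_def G(1) num_verts_max_star[OF n] using bij by blast
qed

section \<open>Maximality and uniqueness of the star\<close>

lemma energy_max_star:
  assumes "2 \<le> n" and "n - 1 \<le> m"
  shows "energy (max_star n m) = 2 * sqrt (real ((m + 2 - n)\<^sup>2 + (n - 2)))"
proof -
  have "energy (max_star n m) =
      2 * sqrt (real (\<Sum>v\<in>{..<n} - {0}. (weight (max_star n m) {0, v})\<^sup>2))"
    using assms max_star_in_weighted_stars[OF assms]
    by (intro energy_star)
      (auto simp: num_verts_max_star edges_max_star weighted_stars_def weighted_trees_def)
  thus ?thesis unfolding sum_max_star[OF assms(1), of "\<lambda>x. x\<^sup>2"] by simp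
qed

text \<open>Both energies are twice the root of a natural number, so comparing them amounts to
  comparing sums of squares of leaf weights. The equality case of the bound singles out the heavy
  leaf needed for the isomorphism.\<close>

lemma energy_weighted_star:
  assumes n: "2 \<le> n" and m: "n - 1 \<le> m" and G: "G \<in> weighted_stars n m"
  shows "energy G \<le> energy (max_star n m)"
    and "energy G = energy (max_star n m) \<Longrightarrow> wgraph_iso G (max_star n m)"
proof -
  obtain c where c: "c < n" and G': "num_verts G = n" "edges G = {{c, v} | v. v < n \<and> v \<noteq> c}"
    and pos: "\<forall>e\<in>edges G. 0 < weight G e"
    and sum: "(\<Sum>v\<in>{..<n} - {c}. weight G {c, v}) = m"
    using G by (rule weighted_starsE) blast
  define I where "I = {..<n} - {c}"
  have I: "finite I" "card I = n - 1" using c by (auto simp: I_def)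
  have ne: "I \<noteq> {}" using I n by auto
  have pos': "\<forall>v\<in>I. 0 < weight G {c, v}"
    using pos unfolding G'(2) I_def by blast
  have a: "(\<Sum>v\<in>I. weight G {c, v}) + 1 - card I = m + 2 - n" "card I - 1 = n - 2"
    using n m I sum by (simp_all add: I_def)
  note energy = energy_star[OF n c G' pos, folded I_def] energy_max_star[OF n m]
  note bound = sum_squares_positive_bound[OF I(1) pos' ne, unfolded a]
  show "energy G \<le> energy (max_star n m)"
    unfolding energy using bound(1)
    by (simp only: mult_le_cancel_left_pos real_sqrt_le_iff of_nat_le_iff zero_less_numeral)
  assume "energy G = energy (max_star n m)"
  hence "(\<Sum>v\<in>I. (weight G {c, v})\<^sup>2) = (m + 2 - n)\<^sup>2 + (n - 2)"
    unfolding energy by (simp only: mult_cancel_left real_sqrt_eq_iff of_nat_eq_iff) simp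
  from bound(2)[OF this] obtain i where "i \<in> I" "weight G {c, i} = m + 2 - n"
    "\<forall>j\<in>I. j \<noteq> i \<longrightarrow> weight G {c, j} = 1" by blast
  thus "wgraph_iso G (max_star n m)"
    using star_iso_max_star[OF n c G', of i m] by (auto simp: I_def)
qed

theorem theorem6:
  fixes n m :: nat
  assumes "2 \<le> n" and "n - 1 \<le> m"
  shows "is_arg_max energy (\<lambda>G. G \<in> weighted_stars n m) (max_star n m) \<and>
    (\<forall>G. is_arg_max energy (\<lambda>G. G \<in> weighted_stars n m) G \<longrightarrow> wgraph_iso G (max_star n m)) \<and>
    energy (max_star n m) = 2 * sqrt ((real m - real n + 2)\<^sup>2 + real n - 2)"
proof (intro conjI allI impI)
  note star = max_star_in_weighted_stars[OF assms]
  show "is_arg_max energy (\<lambda>G. G \<in> weighted_stars n m) (max_star n m)"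
    using star energy_weighted_star(1)[OF assms] by (auto simp: is_arg_max_linorder)
  \<comment> \<open>Two maximisers have equal energy, so the equality case applies.\<close>
  show "wgraph_iso G (max_star n m)"
    if "is_arg_max energy (\<lambda>G. G \<in> weighted_stars n m) G" for G
    using that star energy_weighted_star[OF assms, of G]
    by (auto simp: is_arg_max_linorder intro: order_antisym)
  \<comment> \<open>Both \<open>m + 2 - n\<close> and \<open>n - 2\<close> are untruncated here, so
    they pass to the reals as ordinary differences.\<close>
  show "energy (max_star n m) = 2 * sqrt ((real m - real n + 2)\<^sup>2 + real n - 2)"
    using assms by (simp add: energy_max_star of_nat_diff algebra_simps)
qed

end
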